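(* For every contextuality scenario with only trivial equivalences of measurement effects, $T=(X,Y,K,\mathcal{OE}_P,\emptyset)$, projective measurements are sufficient to recover the quantum set, i.e. $\mathcal{Q}=\mathcal{Q}^{\Pi}$.
   Context: For a positive integer $N$, $[N]=\{0,\dots,N-1\}$. A contextuality scenario with only trivial equivalences of measurement effects is a tuple $T=(X,Y,K,\mathcal{OE}_P,\emptyset)$ where $X,Y,K$ are positive integers (numbers of preparations, measurements, and outcomes per measurement) and $\mathcal{OE}_P=\{\{\alpha^v_j\}_{j\in[V_v]}\}_{v\in[V]}$ is a finite (possibly empty) family in which each $\{\alpha^v_j\}_{j\in[V_v]}$ consists of $V_v\ge 2$ distinct probability distributions on $[X]$. The entry $\emptyset$ means that no equivalences of measurement effects are imposed beyond the completeness of each measurement. A behaviour is a vector $\mathbf{p}=(p(k|x,y))_{x\in[X],y\in[Y],k\in[K]}\in\mathbb{R}^{XYK}$. $\mathcal{Q}$ is the set of behaviours for which there exist a finite-dimensional complex Hilbert space $\mathcal{H}$ (of arbitrary dimension), density operators $\rho_x$ ($x\in[X]$) on $\mathcal{H}$ and POVMs $\{M^y_k\}_{k\in[K]}$ ($y\in[Y]$) on $\mathcal{H}$ (i.e. $M^y_k\ge0$, $\sum_kM^y_k=\mathbb{I}$) such that $p(k|x,y)=\operatorname{tr}(\rho_xM^y_k)$ for all $x,y,k$, and for every $v\in[V]$ the operator $\sum_x\alpha^v_j(x)\rho_x$ is the same for all $j\in[V_v]$. $\mathcal{Q}^{\Pi}\subseteq\mathcal{Q}$ is the set of behaviours admitting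 such a realisation in which in addition every measurement is projective, i.e. $(M^y_k)^2=M^y_k$ for all $y,k$. *)

theory Defs
  imports "Jordan_Normal_Form.Matrix"
begin

section \<open>Contextuality scenarios with only trivial equivalences of measurement effects\<close>

text \<open>The set \<open>[N]\<close> is rendered as \<open>{..<N}\<close>.  Functions on \<open>[N]\<close> are elements of a dependent
  product \<open>\<rightarrow>\<^sub>E\<close>, that is, they are \<open>undefined\<close> outside the index set, so that HOL equality is
  equality of functions on \<open>[N]\<close>.\<close>

definition prob_dists :: "nat \<Rightarrow> (nat \<Rightarrow> real) set" where
  "prob_dists N = {a \<in> {..<N} \<rightarrow>\<^sub>E {0..}. (\<Sum>x<N. a x) = 1}"

text \<open>Since the last component of \<open>(X, Y, K, OE\<^sub>P, \<emptyset>)\<close> is fixed to be empty, it has no field below.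
  The distribution \<open>\<alpha>\<^sup>v\<^sub>j\<close> is \<open>OE\<^sub>P ! v ! j\<close>.\<close>

record scenario =
  num_preps :: nat
  num_meas :: nat
  num_outcomes :: nat
  prep_equivs :: "(nat \<Rightarrow> real) list list"

definition is_scenario :: "scenario \<Rightarrow> bool" where
  "is_scenario T \<longleftrightarrow>
     num_preps T > 0 \<and> num_meas T > 0 \<and> num_outcomes T > 0 \<and>
     (\<forall>as \<in> set (prep_equivs T).
        length as \<ge> 2 \<and> distinct as \<and> set as \<subseteq> prob_dists (num_preps T))"

text \<open>A behaviour is a point of \<open>\<real>\<^sup>X\<^sup>Y\<^sup>K\<close>; the number \<open>p(k|x,y)\<close> is the coordinate \<open>p (x, y, k)\<close>.\<close>

definition behaviours :: "scenario \<Rightarrow> (nat \<times> nat \<times> nat \<Rightarrow> real) set" where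
  "behaviours T =
     ({..<num_preps T} \<times> {..<num_meas T} \<times> {..<num_outcomes T}) \<rightarrow>\<^sub>E UNIV"


section \<open>Operators on the Hilbert space \<open>\<complex>\<^sup>d\<close>\<close>

definition mat_trace :: "'a :: comm_monoid_add mat \<Rightarrow> 'a" where
  "mat_trace A = (\<Sum>i<dim_row A. A $$ (i, i))"

text \<open>There is no zero matrix common to all dimensions, so \<open>sum\<close> does not apply to matrices and the
  dimension is an explicit argument.\<close>

definition mat_sum :: "nat \<Rightarrow> ('i \<Rightarrow> 'a :: comm_monoid_add mat) \<Rightarrow> 'i set \<Rightarrow> 'a mat" where
  "mat_sum d f I = mat d d (\<lambda>(r, c). \<Sum>i\<in>I. f i $$ (r, c))"

text \<open>On complex numbers, \<open>0 \<le> z\<close> means that \<open>z\<close> is real and nonnegative; a matrix satisfying the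
  following is therefore automatically Hermitian.\<close>

definition positive_op :: "nat \<Rightarrow> complex mat \<Rightarrow> bool" where
  "positive_op d A \<longleftrightarrow>
     A \<in> carrier_mat d d \<and> (\<forall>v \<in> carrier_vec d. 0 \<le> (A *\<^sub>v v) \<bullet>c v)"

definition density_op :: "nat \<Rightarrow> complex mat \<Rightarrow> bool" where
  "density_op d \<rho> \<longleftrightarrow> positive_op d \<rho> \<and> mat_trace \<rho> = 1"

definition povm :: "nat \<Rightarrow> nat \<Rightarrow> (nat \<Rightarrow> complex mat) \<Rightarrow> bool" where
  "povm d K M \<longleftrightarrow> (\<forall>k<K. positive_op d (M k)) \<and> mat_sum d M {..<K} = 1\<^sub>m d"

definition projective :: "nat \<Rightarrow> (nat \<Rightarrow> complex mat) \<Rightarrow> bool" where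
  "projective K M \<longleftrightarrow> (\<forall>k<K. M k * M k = M k)"


section \<open>Quantum sets\<close>

definition quantum_realisation ::
  "scenario \<Rightarrow> nat \<Rightarrow> (nat \<Rightarrow> complex mat) \<Rightarrow> (nat \<Rightarrow> nat \<Rightarrow> complex mat)
     \<Rightarrow> (nat \<times> nat \<times> nat \<Rightarrow> real) \<Rightarrow> bool" where
  "quantum_realisation T d \<rho> M p \<longleftrightarrow>
     (\<forall>x<num_preps T. density_op d (\<rho> x)) \<and>
     (\<forall>y<num_meas T. povm d (num_outcomes T) (M y)) \<and>
     (\<forall>x<num_preps T. \<forall>y<num_meas T. \<forall>k<num_outcomes T.
        complex_of_real (p (x, y, k)) = mat_trace (\<rho> x * M y k)) \<and>
     (\<forall>as \<in> set (prep_equivs T). \<forall>a \<in> set as. \<forall>b \<in> set as.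
        mat_sum d (\<lambda>x. complex_of_real (a x) \<cdot>\<^sub>m \<rho> x) {..<num_preps T} =
        mat_sum d (\<lambda>x. complex_of_real (b x) \<cdot>\<^sub>m \<rho> x) {..<num_preps T})"

definition quantum_set :: "scenario \<Rightarrow> (nat \<times> nat \<times> nat \<Rightarrow> real) set" where
  "quantum_set T = {p \<in> behaviours T. \<exists>d \<rho> M. quantum_realisation T d \<rho> M p}"

definition projective_quantum_set :: "scenario \<Rightarrow> (nat \<times> nat \<times> nat \<Rightarrow> real) set" where
  "projective_quantum_set T =
     {p \<in> behaviours T. \<exists>d \<rho> M. quantum_realisation T d \<rho> M p \<and>
        (\<forall>y<num_meas T. projective (num_outcomes T) (M y))}"

end

theory Submission
  imports Defs "Jordan_Normal_Form.Schur_Decomposition"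
begin

text \<open>Factor the elements of a POVM as \<open>M\<^sub>k = A\<^sub>k\<^sup>* A\<^sub>k\<close> and let \<open>V\<close> be the isometry
  \<open>\<psi> \<mapsto> (A\<^sub>k \<psi>)\<^sub>k\<close> from \<open>H\<close> to \<open>H\<^sup>K\<close>.  The block operator \<open>U = [[0, V\<^sup>*], [V, 1 - V V\<^sup>*]]\<close> on
  \<open>H \<oplus> H\<^sup>K\<close> is a self-adjoint unitary, so conjugating the coordinate projections of \<open>H\<^sup>K\<close> with it
  gives a projective measurement whose compression to \<open>H\<close> is the POVM.  The dilation space and the
  embedding of \<open>H\<close> are the same for all measurements; the states \<open>\<rho>\<^sub>x \<oplus> 0\<close> therefore work for all of
  them simultaneously, and they satisfy the same linear relations as the \<open>\<rho>\<^sub>x\<close>.\<close>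

section \<open>Hermitian forms and Gram factorisations of positive matrices\<close>

text \<open>This is the quadratic form \<open>(A *\<^sub>v v) \<bullet>c v\<close>. Matrices and
  vectors are plain functions here, so that changing one coordinate of \<open>v\<close> or passing
  to a Schur complement needs no carrier conditions.\<close>

definition sesq_form :: "nat \<Rightarrow> (nat \<Rightarrow> nat \<Rightarrow> complex) \<Rightarrow> (nat \<Rightarrow> complex) \<Rightarrow> complex" where
  "sesq_form d A v = (\<Sum>r<d. (\<Sum>c<d. A r c * v c) * cnj (v r))"

text \<open>Every test vector used below arises by perturbing one coordinate: a multiple of a unit
  vector, a combination of two unit vectors, and the shift that completes the square for the Schur
  complement.\<close>

lemma sesq_form_add_unit:
  assumes "i < d"
  shows "sesq_form d A (\<lambda>r. v r + (if r = i then t else 0)) =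
    sesq_form d A v + cnj t * (\<Sum>c<d. A i c * v c) + t * (\<Sum>r<d. A r i * cnj (v r))
      + t * cnj t * A i i"
proof -
  have row: "(\<Sum>c<d. A r c * (v c + (if c = i then t else 0)))
    = (\<Sum>c<d. A r c * v c) + A r i * t" for r
    using assms by (simp add: distrib_left sum.distrib if_distrib[of "\<lambda>x. _ * x"] cong: if_cong)
  have col: "(\<Sum>r<d. b r * cnj (v r + (if r = i then t else 0)))
    = (\<Sum>r<d. b r * cnj (v r)) + b i * cnj t" for b
    using assms
    by (simp add: distrib_left sum.distrib if_distrib[of "\<lambda>x. _ * x"] if_distrib[of cnj]
        cong: if_cong)
  have "(\<Sum>r<d. A r i * t * cnj (v r)) = t * (\<Sum>r<d. A r i * cnj (v r))"
    by (simp add: sum_distrib_left mult_ac)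
  then show ?thesis
    unfolding sesq_form_def row col by (simp add: sum.distrib algebra_simps)
qed

lemma sesq_form_unit:
  assumes "i < d"
  shows "sesq_form d A (\<lambda>r. if r = i then t else 0) = t * cnj t * A i i"
  using sesq_form_add_unit[OF assms, of A "\<lambda>_. 0" t] by (simp add: sesq_form_def)

lemma sesq_form_two_units:
  assumes "i < d" "j < d"
  shows "sesq_form d A (\<lambda>r. (if r = j then 1 else 0) + (if r = i then t else 0)) =
    A j j + cnj t * A i j + t * A j i + t * cnj t * A i i"
proof -
  have "(\<Sum>c<d. A i c * (if c = j then 1 else 0)) = A i j"
    "(\<Sum>r<d. A r i * cnj (if r = j then 1 else 0)) = A j i"
    using assms by (simp_all add: if_distrib[of "\<lambda>x. _ * x"] if_distrib[of cnj] cong: if_cong)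
  then show ?thesis
    unfolding sesq_form_add_unit[OF assms(1)] using sesq_form_unit[OF assms(2), of A 1] by simp
qed

lemma sesq_form_nonneg_diag:
  assumes "\<And>v. 0 \<le> sesq_form d A v" "i < d"
  shows "0 \<le> A i i"
  using assms(1)[of "\<lambda>r. if r = i then 1 else 0"] sesq_form_unit[OF assms(2), of A 1] by simp

text \<open>The values of the form at \<open>e_j + t e_i\<close> are real. For \<open>t = 1\<close>
  this cancels the imaginary parts of \<open>A i j\<close> and \<open>A j i\<close>; for
  \<open>t = \<i>\<close> it equates their real parts.\<close>

lemma sesq_form_nonneg_hermitian:
  assumes pos: "\<And>v. 0 \<le> sesq_form d A v" and ij: "i < d" "j < d"
  shows "A j i = cnj (A i j)"
proof -
  have real: "Im (A i i) = 0" "Im (A j j) = 0"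
    using sesq_form_nonneg_diag[OF pos] ij by (simp_all add: less_eq_complex_def)
  have "0 \<le> A j j + cnj t * A i j + t * A j i + t * cnj t * A i i" for t
    using pos[of "\<lambda>r. (if r = j then 1 else 0) + (if r = i then t else 0)"]
    unfolding sesq_form_two_units[OF ij] .
  from this[of 1] this[of \<i>] real show ?thesis
    by (simp add: less_eq_complex_def complex_eq_iff)
qed

text \<open>Without the quadratic term in \<open>t\<close>, the form at \<open>e_j + t e_i\<close>
  is affine in the real and imaginary parts of \<open>t\<close>. If \<open>A i j\<close> were
  nonzero, it would be unbounded below.\<close>

lemma sesq_form_nonneg_zero_diag:
  assumes pos: "\<And>v. 0 \<le> sesq_form d A v" and ij: "i < d" "j < d" and zero: "A i i = 0"
  shows "A i j = 0"
proof (rule ccontr)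
  assume nz: "A i j \<noteq> 0"
  \<comment> \<open>The scale is chosen so that the form at \<open>e_j + t e_i\<close> has real part
    \<open>-1\<close>.\<close>
  define s where "s = (Re (A j j) + 1) / (2 * (cmod (A i j))\<^sup>2)"
  define t where "t = - complex_of_real s * A i j"
  have "0 \<le> A j j + cnj t * A i j + t * A j i"
    using pos[of "\<lambda>r. (if r = j then 1 else 0) + (if r = i then t else 0)"]
      sesq_form_two_units[OF ij, of A t] zero by simp
  also have "cnj t * A i j + t * A j i = - complex_of_real (2 * s * (cmod (A i j))\<^sup>2)"
    unfolding sesq_form_nonneg_hermitian[OF pos ij] t_def
    by (simp add: complex_norm_square[symmetric] mult.assoc mult.commute[of "cnj (A i j)"]
        flip: of_real_power)
  then have "A j j + cnj t * A i j + t * A j i = A j j - complex_of_real (2 * s * (cmod (A i j))\<^sup>2)"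
    by (simp add: add.assoc)
  also have "2 * s * (cmod (A i j))\<^sup>2 = Re (A j j) + 1"
    using nz by (simp add: s_def)
  finally show False by (simp add: less_eq_complex_def)
qed

text \<open>Completing the square: with \<open>z\<close> the coordinate \<open>i\<close> of
  \<open>A v\<close>, the form of the complement at \<open>v\<close> equals the form of
  \<open>A\<close> at \<open>v\<close> with coordinate \<open>i\<close> shifted by
  \<open>- z / A i i\<close>. If the pivot is \<open>0\<close>, division by zero gives
  \<open>0\<close> and the complement is \<open>A\<close> itself.\<close>

lemma sesq_form_schur_complement_nonneg:
  assumes pos: "\<And>v. 0 \<le> sesq_form d A v" and i: "i < d"
  shows "0 \<le> sesq_form d (\<lambda>r c. A r c - A r i * A i c / A i i) v"
proof (cases "A i i = 0")
  case True
  then show ?thesis using pos by simp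
next
  case False
  define z where "z = (\<Sum>c<d. A i c * v c)"
  have real: "cnj (A i i) = A i i"
    using sesq_form_nonneg_hermitian[OF pos i i] by simp
  have z': "(\<Sum>r<d. A r i * cnj (v r)) = cnj z"
    unfolding z_def cnj_sum
    by (rule sum.cong) (use sesq_form_nonneg_hermitian[OF pos i] in auto)
  have "sesq_form d (\<lambda>r c. A r c - A r i * A i c / A i i) v
    = (\<Sum>r<d. \<Sum>c<d. A r c * v c * cnj (v r) - (A r i * cnj (v r)) * (A i c * v c) / A i i)"
    unfolding sesq_form_def sum_distrib_right
    by (intro sum.cong refl) (use False in \<open>simp add: field_simps\<close>)
  also have "\<dots> = sesq_form d A v - (\<Sum>r<d. \<Sum>c<d. (A r i * cnj (v r)) * (A i c * v c)) / A i i"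
    by (simp add: sesq_form_def sum_subtractf sum_divide_distrib sum_distrib_right)
  also have "(\<Sum>r<d. \<Sum>c<d. (A r i * cnj (v r)) * (A i c * v c)) = cnj z * z"
    unfolding z'[symmetric] unfolding z_def sum_product by (rule refl)
  also have "sesq_form d A v - cnj z * z / A i i =
     sesq_form d A (\<lambda>r. v r + (if r = i then - z / A i i else 0))"
    unfolding sesq_form_add_unit[OF i] z' z_def[symmetric] using False real
    by (simp add: field_simps)
  finally show ?thesis using pos by simp
qed

text \<open>Eliminating one index of \<open>S\<close> splits off a rank-one term and leaves its Schur complement.  If
  the pivot \<open>A i i\<close> vanishes, then so do its row and column, and the convention \<open>x / 0 = 0\<close> makes
  the rank-one term \<open>0\<close>.\<close>

lemma sesq_form_nonneg_gram_on:
  assumes "finite S" "S \<subseteq> {..<d}" "\<And>v. 0 \<le> sesq_form d A v"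
    "\<And>r c. r < d \<Longrightarrow> c < d \<Longrightarrow> r \<notin> S \<or> c \<notin> S \<Longrightarrow> A r c = 0"
  shows "\<exists>w. \<forall>r<d. \<forall>c<d. A r c = (\<Sum>i\<in>S. cnj (w i r) * w i c)"
  using assms
proof (induction S arbitrary: A rule: finite_induct)
  case empty
  then show ?case by simp
next
  case (insert i S)
  note pos = insert.prems(2)
  have i: "i < d" using insert.prems(1) by simp
  have herm: "A r i = cnj (A i r)" if "r < d" for r
    using sesq_form_nonneg_hermitian[OF pos i that] .
  have zero: "A i r = 0" "A r i = 0" if "A i i = 0" "r < d" for r
    using sesq_form_nonneg_zero_diag[OF pos i that(2,1)] herm[OF that(2)] by simp_all
  define B where "B r c = A r c - A r i * A i c / A i i" for r c
  have "B r c = 0" if "r < d" "c < d" "r \<notin> S \<or> c \<notin> S" for r c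
  \<comment> \<open>Row and column \<open>i\<close> of \<open>B\<close> cancel when the pivot is
    nonzero, and are already zero in \<open>A\<close> otherwise.\<close>
  proof (cases "r = i \<or> c = i")
    case True
    then show ?thesis using zero that by (cases "A i i = 0") (auto simp: B_def)
  next
    case False
    with that have "A r c = 0" "A r i = 0 \<or> A i c = 0" using insert.prems(3) i by auto
    then show ?thesis by (auto simp: B_def)
  qed
  moreover have "0 \<le> sesq_form d B v" for v
    unfolding B_def using sesq_form_schur_complement_nonneg[OF pos i] .
  ultimately obtain w where w: "\<forall>r<d. \<forall>c<d. B r c = (\<Sum>j\<in>S. cnj (w j r) * w j c)"
    using insert.IH[of B] insert.prems(1) by auto
  \<comment> \<open>Dividing row \<open>i\<close> by the real root \<open>s\<close> of the pivot
    turns the rank-one term into a Gram term, since Hermitian symmetry rewrites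
    \<open>cnj (A i r)\<close> as \<open>A r i\<close>.\<close>
  define s where "s = complex_of_real (sqrt (Re (A i i)))"
  have s: "s * s = A i i" "cnj s = s"
    using sesq_form_nonneg_diag[OF pos i]
    by (simp_all add: s_def less_eq_complex_def complex_eq_iff)
  have "A r c = (\<Sum>j\<in>insert i S. cnj ((w(i := \<lambda>c. A i c / s)) j r) * (w(i := \<lambda>c. A i c / s)) j c)"
    if "r < d" "c < d" for r c
  proof -
    have "A r c = A r i * A i c / A i i + (\<Sum>j\<in>S. cnj (w j r) * w j c)"
      using w that by (simp add: B_def diff_eq_eq)
    moreover have "(\<Sum>j\<in>S. cnj ((w(i := \<lambda>c. A i c / s)) j r) * (w(i := \<lambda>c. A i c / s)) j c)
      = (\<Sum>j\<in>S. cnj (w j r) * w j c)"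
      using insert.hyps by (intro sum.cong) auto
    ultimately show ?thesis
      using insert.hyps s herm[OF that(1)] by simp
  qed
  then show ?case by blast
qed

text \<open>The form reads only the first \<open>d\<close> values of \<open>v\<close>, so
  quantifying over all functions amounts to quantifying over \<open>carrier_vec d\<close>.\<close>

lemma positive_op_sesq_form:
  assumes "A \<in> carrier_mat d d"
  shows "positive_op d A \<longleftrightarrow> (\<forall>v. 0 \<le> sesq_form d (\<lambda>r c. A $$ (r, c)) v)"
proof -
  have eq: "(A *\<^sub>v u) \<bullet>c u = sesq_form d (\<lambda>r c. A $$ (r, c)) (\<lambda>i. u $ i)" if "u \<in> carrier_vec d" for u
    using assms that
    by (auto simp: sesq_form_def scalar_prod_def atLeast0LessThan intro!: sum.cong)
  have restrict: "sesq_form d (\<lambda>r c. A $$ (r, c)) (\<lambda>i. vec d v $ i) = sesq_form d (\<lambda>r c. A $$ (r, c)) v" for v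
    by (simp add: sesq_form_def)
  have "0 \<le> sesq_form d (\<lambda>r c. A $$ (r, c)) v"
    if "\<forall>u \<in> carrier_vec d. 0 \<le> (A *\<^sub>v u) \<bullet>c u" for v
    using bspec[OF that vec_carrier[of d v]] unfolding eq[OF vec_carrier] restrict .
  then show ?thesis
    unfolding positive_op_def using assms eq by auto
qed

text \<open>This takes the place of the operator square root: the dilation needs only some factor
  whose Gram matrix is \<open>A\<close>.\<close>

lemma positive_op_gram:
  assumes "positive_op d A"
  obtains w where "\<And>r c. r < d \<Longrightarrow> c < d \<Longrightarrow> A $$ (r, c) = (\<Sum>i<d. cnj (w i r) * w i c)"
proof -
  have "A \<in> carrier_mat d d" using assms by (simp add: positive_op_def)
  then have "0 \<le> sesq_form d (\<lambda>r c. A $$ (r, c)) v" for v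
    using assms positive_op_sesq_form by blast
  then have "\<exists>w. \<forall>r<d. \<forall>c<d. A $$ (r, c) = (\<Sum>i\<in>{..<d}. cnj (w i r) * w i c)"
    by (intro sesq_form_nonneg_gram_on) auto
  then show ?thesis using that by blast
qed

section \<open>Adjoints, orthogonal projections and conjugated sums\<close>

lemma mat_adjoint_index [simp]:
  assumes "i < dim_col A" "j < dim_row A"
  shows "mat_adjoint A $$ (i, j) = conjugate (A $$ (j, i))"
  using assms by (simp add: mat_adjoint_def mat_of_rows_index)

lemma mat_adjoint_dim [simp]:
  "dim_row (mat_adjoint A) = dim_col A" "dim_col (mat_adjoint A) = dim_row A"
  by (simp_all add: mat_adjoint_def)

lemma mat_adjoint_self_index:
  assumes "mat_adjoint A = A" "i < dim_col A" "j < dim_row A"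
  shows "conjugate (A $$ (j, i)) = A $$ (i, j)"
  using mat_adjoint_index[OF assms(2,3)] assms(1) by metis

lemma mat_adjoint_adjoint [simp]: "mat_adjoint (mat_adjoint A) = A"
  by (rule eq_matI) auto

lemma mat_adjoint_four_block_mat:
  assumes "A \<in> carrier_mat n m" "B \<in> carrier_mat n l" "C \<in> carrier_mat k m" "D \<in> carrier_mat k l"
  shows "mat_adjoint (four_block_mat A B C D) =
    four_block_mat (mat_adjoint A) (mat_adjoint C) (mat_adjoint B) (mat_adjoint D)"
  using assms by (intro eq_matI) auto

lemma mat_adjoint_mult:
  fixes A B :: "complex mat"
  assumes "A \<in> carrier_mat n m" "B \<in> carrier_mat m l"
  shows "mat_adjoint (A * B) = mat_adjoint B * mat_adjoint A"
  using assms
  by (intro eq_matI) (auto simp: scalar_prod_def mult.commute intro!: sum.cong)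

text \<open>Idempotence followed by self-adjointness turns
  \<open>(A *\<^sub>v v) \<bullet>c v\<close> into the squared norm of
  \<open>A *\<^sub>v v\<close>.\<close>

lemma positive_op_hermitian_idempotent:
  assumes A: "A \<in> carrier_mat d d" and herm: "mat_adjoint A = A" and idem: "A * A = A"
  shows "positive_op d A"
  unfolding positive_op_def
proof (intro conjI ballI A)
  fix v :: "complex vec" assume v: "v \<in> carrier_vec d"
  have "(A *\<^sub>v v) \<bullet>c v = (A *\<^sub>v (A *\<^sub>v v)) \<bullet>c v"
    using assoc_mult_mat_vec[OF A A v] idem by simp
  also have "\<dots> = (A *\<^sub>v v) \<bullet>c (A *\<^sub>v v)"
  proof -
    have entry: "cnj (A $$ (c, r)) = A $$ (r, c)" if "r < d" "c < d" for r c
      using mat_adjoint_self_index[OF herm, of r c] A that by auto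
    have lhs: "(A *\<^sub>v u) \<bullet>c v = (\<Sum>r<d. \<Sum>c<d. A $$ (r, c) * u $ c * cnj (v $ r))"
      if "u \<in> carrier_vec d" for u
      using A v that by (auto simp: scalar_prod_def atLeast0LessThan sum_distrib_right intro!: sum.cong)
    have rhs: "u \<bullet>c (A *\<^sub>v v) = (\<Sum>c<d. \<Sum>r<d. A $$ (r, c) * u $ c * cnj (v $ r))"
      if "u \<in> carrier_vec d" for u
      using A v that
      by (auto simp: scalar_prod_def atLeast0LessThan sum_distrib_left entry mult_ac intro!: sum.cong)
    show ?thesis
      unfolding lhs[OF mult_mat_vec_carrier[OF A v]] rhs[OF mult_mat_vec_carrier[OF A v]]
      by (rule sum.swap)
  qed
  also have "0 \<le> \<dots>" by (rule conjugate_square_ge_0_vec)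
  finally show "0 \<le> (A *\<^sub>v v) \<bullet>c v" .
qed

text \<open>With both outer factors equal to a self-adjoint unitary, this carries the completeness
  of a measurement over to its conjugate.\<close>

lemma mat_sum_sandwich:
  fixes A B :: "'a :: comm_semiring_1 mat"
  assumes "A \<in> carrier_mat n n" "B \<in> carrier_mat n n" "\<And>k. k \<in> I \<Longrightarrow> f k \<in> carrier_mat n n"
  shows "mat_sum n (\<lambda>k. A * f k * B) I = A * mat_sum n f I * B"
proof (rule eq_matI)
  fix r c assume "r < dim_row (A * mat_sum n f I * B)" "c < dim_col (A * mat_sum n f I * B)"
  then have rc: "r < n" "c < n" using assms by auto
  have entry: "(A * C * B) $$ (r, c) = (\<Sum>i<n. \<Sum>j<n. A $$ (r, i) * C $$ (i, j) * B $$ (j, c))"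
    if "C \<in> carrier_mat n n" for C
    using assms rc that
    by (auto simp: scalar_prod_def atLeast0LessThan sum_distrib_left mult.assoc intro!: sum.cong)
  have "mat_sum n (\<lambda>k. A * f k * B) I $$ (r, c)
    = (\<Sum>k\<in>I. \<Sum>i<n. \<Sum>j<n. A $$ (r, i) * f k $$ (i, j) * B $$ (j, c))"
    using rc assms by (auto simp: mat_sum_def entry simp del: index_mult_mat intro!: sum.cong)
  also have "\<dots> = (\<Sum>i<n. \<Sum>j<n. A $$ (r, i) * mat_sum n f I $$ (i, j) * B $$ (j, c))"
    unfolding sum.swap[of _ _ I]
    by (auto simp: mat_sum_def sum_distrib_left sum_distrib_right intro!: sum.cong)
  also have "\<dots> = (A * mat_sum n f I * B) $$ (r, c)"
    by (rule entry[symmetric]) (simp add: mat_sum_def)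
  finally show "mat_sum n (\<lambda>k. A * f k * B) I $$ (r, c) = (A * mat_sum n f I * B) $$ (r, c)" .
qed (use assms in \<open>auto simp: mat_sum_def\<close>)

section \<open>Dilation of isometries and of POVMs\<close>

text \<open>The \<open>K\<close>-fold direct sum of the \<open>d\<close>-dimensional space is
  indexed by \<open>s = k * d + i\<close>, with \<open>k\<close> the block and \<open>i\<close> the
  position inside it.\<close>

lemma sum_div_mod:
  fixes g :: "nat \<Rightarrow> nat \<Rightarrow> 'a :: comm_monoid_add"
  shows "(\<Sum>s<K * d. g (s div d) (s mod d)) = (\<Sum>k<K. \<Sum>i<d. g k i)"
proof -
  have "(\<Sum>s<K * d. g (s div d) (s mod d)) = (\<Sum>k<K. \<Sum>s=k * d..<k * d + d. g (s div d) (s mod d))"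
    by (rule sum.nat_group[symmetric])
  also have "\<dots> = (\<Sum>k<K. \<Sum>i<d. g k i)"
  proof (rule sum.cong[OF refl])
    fix k
    have "(\<Sum>s=k * d..<k * d + d. g (s div d) (s mod d))
      = (\<Sum>i=0..<d. g ((i + k * d) div d) ((i + k * d) mod d))"
      using sum.shift_bounds_nat_ivl[of "\<lambda>s. g (s div d) (s mod d)" 0 "k * d" d]
      by (simp add: add.commute)
    also have "\<dots> = (\<Sum>i<d. g k i)"
      by (rule sum.cong) auto
    finally show "(\<Sum>s=k * d..<k * d + d. g (s div d) (s mod d)) = (\<Sum>i<d. g k i)" .
  qed
  finally show ?thesis .
qed

text \<open>Up to signs and the order of the blocks, \<open>U\<close> is the Halmos dilation of
  \<open>V\<close>: the defect of \<open>V\<close> is \<open>0\<close>, and that of its adjoint is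
  the projection \<open>?R\<close> onto the orthogonal complement of the range of \<open>V\<close>.
  Hence \<open>?W * ?R = 0\<close>, \<open>?R * V = 0\<close> and \<open>?R * ?R = ?R\<close>, so
  the off-diagonal blocks of \<open>U * U\<close> vanish and the diagonal ones are
  identities.\<close>

lemma isometry_halmos_dilation:
  fixes V :: "complex mat"
  assumes V: "V \<in> carrier_mat m d" and iso: "mat_adjoint V * V = 1\<^sub>m d"
  defines "U \<equiv> four_block_mat (0\<^sub>m d d) (mat_adjoint V) V (1\<^sub>m m - V * mat_adjoint V)"
  shows "U * U = 1\<^sub>m (d + m)" "mat_adjoint U = U"
proof -
  let ?W = "mat_adjoint V"
  let ?R = "1\<^sub>m m - V * ?W"
  have W: "?W \<in> carrier_mat d m" using V by auto
  have VW: "V * ?W \<in> carrier_mat m m" using V W by simp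
  have R: "?R \<in> carrier_mat m m" using VW by (rule minus_carrier_mat)
  have WR: "?W * ?R = 0\<^sub>m d m"
  proof -
    have "?W * (V * ?W) = ?W"
      by (simp only: iso left_mult_one_mat[OF W] flip: assoc_mult_mat[OF W V W])
    then show ?thesis using mult_minus_distrib_mat[OF W one_carrier_mat VW] right_mult_one_mat[OF W]
        minus_r_inv_mat[OF W] by simp
  qed
  have RV: "?R * V = 0\<^sub>m m d"
  proof -
    have "(V * ?W) * V = V"
      by (simp only: assoc_mult_mat[OF V W V] iso right_mult_one_mat[OF V])
    then show ?thesis using minus_mult_distrib_mat[OF one_carrier_mat VW V] left_mult_one_mat[OF V]
        minus_r_inv_mat[OF V] by simp
  qed
  have RR: "?R * ?R = ?R"
  proof -
    have "?R * (V * ?W) = 0\<^sub>m m m"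
      by (simp only: RV left_mult_zero_mat[OF W] flip: assoc_mult_mat[OF R V W])
    then have "?R * ?R = ?R * 1\<^sub>m m - 0\<^sub>m m m"
      using mult_minus_distrib_mat[OF R one_carrier_mat VW] by simp
    moreover have "G - 0\<^sub>m m m = G" if "G \<in> carrier_mat m m" for G :: "complex mat"
      using that by (intro eq_matI) auto
    ultimately show ?thesis using R by (simp only: right_mult_one_mat)
  qed
  have "G + (1\<^sub>m m - G) = 1\<^sub>m m" if "G \<in> carrier_mat m m" for G :: "complex mat"
    using that by (intro eq_matI) auto
  note add_compl = this[OF VW]
  show "U * U = 1\<^sub>m (d + m)"
    unfolding U_def mult_four_block_mat[OF zero_carrier_mat W V R zero_carrier_mat W V R]
      WR RV RR iso add_compl
    by (simp only: left_mult_zero_mat[OF zero_carrier_mat] left_mult_zero_mat[OF W]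
        right_mult_zero_mat[OF V] left_add_zero_mat[OF one_carrier_mat]
        left_add_zero_mat[OF zero_carrier_mat] four_block_one_mat)
  have VW_herm: "mat_adjoint (V * ?W) = V * ?W"
    unfolding mat_adjoint_mult[OF V W] mat_adjoint_adjoint by (rule refl)
  have "mat_adjoint (1\<^sub>m m - G) = 1\<^sub>m m - G"
    if "G \<in> carrier_mat m m" "mat_adjoint G = G" for G :: "complex mat"
    using that mat_adjoint_self_index[OF that(2)]
    by (intro eq_matI) (auto simp: conjugate_complex_def)
  note R_herm = this[OF VW VW_herm]
  have zero_herm: "mat_adjoint (0\<^sub>m d d :: complex mat) = 0\<^sub>m d d"
    by (intro eq_matI) auto
  show "mat_adjoint U = U"
    unfolding U_def mat_adjoint_four_block_mat[OF zero_carrier_mat W V R]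
      zero_herm R_herm mat_adjoint_adjoint by (rule refl)
qed

text \<open>In the proof, \<open>V\<close> stacks Gram factors of the \<open>M k\<close>, so that compressing the \<open>k\<close>-th coordinate block by \<open>V\<close>
  gives \<open>M k\<close>.  The summand \<open>\<complex>\<^sup>d\<close> is assigned to the outcome \<open>0\<close>; this does not affect the
  compression because the corresponding block of \<open>U\<close> vanishes.\<close>

lemma povm_dilation:
  assumes povm: "povm d K M" and K: "K > 0"
  shows "\<exists>P. povm (d + K * d) K P \<and> projective K P \<and>
    (\<forall>k<K. \<forall>r<d. \<forall>c<d. P k $$ (r, c) = M k $$ (r, c))"
proof -
  let ?m = "K * d"
  have "\<forall>k. \<exists>w. k < K \<longrightarrow> (\<forall>r<d. \<forall>c<d. M k $$ (r, c) = (\<Sum>i<d. cnj (w i r) * w i c))"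
    using povm positive_op_gram unfolding povm_def by metis
  then obtain w where w: "\<And>k r c. k < K \<Longrightarrow> r < d \<Longrightarrow> c < d \<Longrightarrow>
      M k $$ (r, c) = (\<Sum>i<d. cnj (w k i r) * w k i c)"
    by metis
  define V where "V = mat ?m d (\<lambda>(s, c). w (s div d) (s mod d) c)"
  define E where "E k = mat ?m ?m (\<lambda>(r, c). if r = c then (if r div d = k then 1 else 0) else 0 :: complex)" for k
  let ?W = "mat_adjoint V"
  have V: "V \<in> carrier_mat ?m d" and W: "?W \<in> carrier_mat d ?m" by (auto simp: V_def)
  have E: "E k \<in> carrier_mat ?m ?m" for k by (simp add: E_def)
  have compress: "(?W * E k * V) $$ (r, c) = M k $$ (r, c)" if "k < K" "r < d" "c < d" for k r c
  proof -
    have WE: "(?W * E k) $$ (r, s) = (if s div d = k then cnj (V $$ (s, r)) else 0)"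
      if "s < ?m" for s
      using that \<open>r < d\<close> V
      by (auto simp: E_def scalar_prod_def if_distrib[of "\<lambda>x. _ * x"] cong: if_cong)
    have prod: "(C * V) $$ (r, c) = (\<Sum>s<?m. C $$ (r, s) * V $$ (s, c))" if "C \<in> carrier_mat d ?m" for C
      using that V \<open>r < d\<close> \<open>c < d\<close> by (auto simp: scalar_prod_def atLeast0LessThan intro!: sum.cong)
    \<comment> \<open>As \<open>E k\<close> is diagonal, only indices in block \<open>k\<close>
      contribute, and summing block by block leaves the Gram sum for \<open>M k\<close>.\<close>
    have "(?W * E k * V) $$ (r, c) = (\<Sum>s<?m. (?W * E k) $$ (r, s) * V $$ (s, c))"
      by (rule prod) (use W E[of k] in auto)
    also have "\<dots> = (\<Sum>s<?m. if s div d = k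
        then cnj (w (s div d) (s mod d) r) * w (s div d) (s mod d) c else 0)"
      using that by (intro sum.cong refl) (simp only: lessThan_iff WE, simp add: V_def)
    also have "\<dots> = (\<Sum>l<K. \<Sum>i<d. if l = k then cnj (w l i r) * w l i c else 0)"
      by (rule sum_div_mod)
    also have "\<dots> = (\<Sum>l<K. if l = k then \<Sum>i<d. cnj (w l i r) * w l i c else 0)"
      by (rule sum.cong) auto
    also have "\<dots> = M k $$ (r, c)" using w that by simp
    finally show ?thesis .
  qed
  \<comment> \<open>Without the selection of a block, the same sum runs over all outcomes, so
    completeness of the POVM makes \<open>V\<close> an isometry.\<close>
  have iso: "?W * V = 1\<^sub>m d"
  proof (rule eq_matI)
    fix r c assume "r < dim_row (1\<^sub>m d)" "c < dim_col (1\<^sub>m d)"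
    then have rc: "r < d" "c < d" by auto
    have "(?W * V) $$ (r, c) = (\<Sum>s<?m. cnj (w (s div d) (s mod d) r) * w (s div d) (s mod d) c)"
      using rc by (simp add: V_def scalar_prod_def atLeast0LessThan)
    also have "\<dots> = (\<Sum>k<K. \<Sum>i<d. cnj (w k i r) * w k i c)"
      by (rule sum_div_mod)
    also have "\<dots> = mat_sum d M {..<K} $$ (r, c)"
      using rc w by (simp add: mat_sum_def)
    finally show "(?W * V) $$ (r, c) = 1\<^sub>m d $$ (r, c)"
      using povm by (simp add: povm_def)
  qed (use V in auto)
  define U where "U = four_block_mat (0\<^sub>m d d) ?W V (1\<^sub>m ?m - V * ?W)"
  define D where "D k = four_block_mat (if k = 0 then 1\<^sub>m d else 0\<^sub>m d d) (0\<^sub>m d ?m) (0\<^sub>m ?m d) (E k)" for k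
  define P where "P k = U * D k * U" for k
  have U: "U \<in> carrier_mat (d + ?m) (d + ?m)" using V by (auto simp: U_def)
  have D: "D k \<in> carrier_mat (d + ?m) (d + ?m)" for k using E[of k] by (auto simp: D_def)
  have P: "P k \<in> carrier_mat (d + ?m) (d + ?m)" for k using U D by (auto simp: P_def)
  have UU: "U * U = 1\<^sub>m (d + ?m)" and U_herm: "mat_adjoint U = U"
    using isometry_halmos_dilation[OF V iso] by (simp_all add: U_def)
  have D_herm: "mat_adjoint (D k) = D k" for k
    by (rule eq_matI) (auto simp: D_def E_def)
  have EE: "E k * E k = E k" for k
    by (rule eq_matI) (auto simp: E_def scalar_prod_def if_distrib[of "\<lambda>x. _ * x"] cong: if_cong)
  have DD: "D k * D k = D k" for k
    unfolding D_def by (subst mult_four_block_mat) (use E[of k] EE in auto)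
  have PP: "P k * P k = P k" for k
  proof -
    have "P k * P k = U * (D k * (U * U) * D k) * U"
      using U D[of k] by (simp add: P_def assoc_mult_mat[where ?n\<^sub>1 = "d + ?m" and ?n\<^sub>2 = "d + ?m"
            and ?n\<^sub>3 = "d + ?m" and ?n\<^sub>4 = "d + ?m"])
    then show ?thesis using D[of k] by (simp add: UU DD P_def)
  qed
  have P_herm: "mat_adjoint (P k) = P k" for k
    using U D[of k] mat_adjoint_mult[OF mult_carrier_mat[OF U D[of k]] U] mat_adjoint_mult[OF U D[of k]]
      assoc_mult_mat[OF U D[of k] U]
    by (simp add: P_def U_herm D_herm)
  have "mat_sum (d + ?m) D {..<K} = 1\<^sub>m (d + ?m)"
  proof (rule eq_matI)
    fix r c assume "r < dim_row (1\<^sub>m (d + ?m) :: complex mat)" "c < dim_col (1\<^sub>m (d + ?m) :: complex mat)"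
    then have rc: "r < d + ?m" "c < d + ?m" by auto
    \<comment> \<open>Each coordinate must belong to exactly one outcome below \<open>K\<close>: its
      block number in the second summand, and outcome \<open>0\<close> in the first, where
      \<open>K > 0\<close> enters.\<close>
    have block: "(r - d) div d < K" if "\<not> r < d"
      using that rc by (simp add: less_mult_imp_div_less)
    have "D k $$ (r, c) =
        (if k = (if r < d then 0 else (r - d) div d) then (if r = c then 1 else 0) else 0)" for k
      by (cases "r < d"; cases "c < d") (use rc in \<open>auto simp: D_def E_def\<close>)
    then have "mat_sum (d + ?m) D {..<K} $$ (r, c) =
      (\<Sum>k<K. if k = (if r < d then 0 else (r - d) div d) then (if r = c then 1 else 0) else 0)"
      using rc by (simp only: mat_sum_def index_mat prod.case)
    then show "mat_sum (d + ?m) D {..<K} $$ (r, c) = 1\<^sub>m (d + ?m) $$ (r, c)"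
      using rc K block by (cases "r < d") simp_all
  qed (auto simp: mat_sum_def)
  moreover have "mat_sum (d + ?m) P {..<K} = U * mat_sum (d + ?m) D {..<K} * U"
    unfolding P_def by (rule mat_sum_sandwich[OF U U D])
  ultimately have "mat_sum (d + ?m) P {..<K} = 1\<^sub>m (d + ?m)"
    by (simp only: right_mult_one_mat[OF U] UU)
  then have "povm (d + ?m) K P"
    unfolding povm_def using positive_op_hermitian_idempotent[OF P P_herm PP] by blast
  moreover have "projective K P" using PP by (simp add: projective_def)
  moreover have "P k $$ (r, c) = M k $$ (r, c)" if "k < K" "r < d" "c < d" for k r c
  proof -
    let ?R = "1\<^sub>m ?m - V * ?W" and ?B = "if k = 0 then 1\<^sub>m d else 0\<^sub>m d d :: complex mat"
    have R: "?R \<in> carrier_mat ?m ?m" using V W by (intro minus_carrier_mat) simp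
    have B: "?B \<in> carrier_mat d d" by simp
    have WE: "?W * E k \<in> carrier_mat d ?m" and VB: "V * ?B \<in> carrier_mat ?m d"
      and RE: "?R * E k \<in> carrier_mat ?m ?m"
      by (rule mult_carrier_mat[OF W E] mult_carrier_mat[OF V B] mult_carrier_mat[OF R E])+
    have UD: "U * D k = four_block_mat (0\<^sub>m d d) (?W * E k) (V * ?B) (?R * E k)"
      unfolding U_def D_def
        mult_four_block_mat[OF zero_carrier_mat W V R B zero_carrier_mat zero_carrier_mat E]
      by (simp only: left_mult_zero_mat[OF B] right_mult_zero_mat[OF W] right_mult_zero_mat[OF V]
          left_mult_zero_mat[OF zero_carrier_mat] right_mult_zero_mat[OF R]
          left_add_zero_mat[OF zero_carrier_mat] left_add_zero_mat[OF WE]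
          right_add_zero_mat[OF VB] left_add_zero_mat[OF RE])
    have WEV: "?W * E k * V \<in> carrier_mat d d"
      by (rule mult_carrier_mat[OF WE V])
    have "four_block_mat F G H J $$ (r, c) = F $$ (r, c)" if "F \<in> carrier_mat d d"
      for F G H J :: "complex mat"
      using that \<open>r < d\<close> \<open>c < d\<close> by simp
    note top_left = this[OF WEV]
    have "P k $$ (r, c) = (?W * E k * V) $$ (r, c)"
      unfolding P_def UD
      unfolding U_def mult_four_block_mat[OF zero_carrier_mat WE VB RE zero_carrier_mat W V R]
        left_mult_zero_mat[OF zero_carrier_mat] left_add_zero_mat[OF WEV] top_left by (rule refl)
    then show ?thesis using compress that by simp
  qed
  ultimately show ?thesis by blast
qed

section \<open>Extension of states by zero\<close>

definition pad_mat :: "nat \<Rightarrow> nat \<Rightarrow> 'a :: zero mat \<Rightarrow> 'a mat" where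
  "pad_mat d n A = mat n n (\<lambda>(r, c). if r < d \<and> c < d then A $$ (r, c) else 0)"

lemma sum_lessThan_restrict:
  fixes f :: "nat \<Rightarrow> 'a :: comm_monoid_add"
  assumes "d \<le> n"
  shows "(\<Sum>i<n. if i < d then f i else 0) = (\<Sum>i<d. f i)"
proof -
  have "{..<n} \<inter> {i. i < d} = {..<d}" using assms by auto
  then show ?thesis by (simp add: sum.If_cases)
qed

text \<open>The form of the padded matrix at \<open>v\<close> is the form of \<open>\<rho>\<close>
  at the first \<open>d\<close> coordinates of \<open>v\<close>, and the trace gains only
  zeros.\<close>

lemma density_op_pad_mat:
  assumes "density_op d \<rho>" "d \<le> n"
  shows "density_op n (pad_mat d n \<rho>)"
proof -
  have \<rho>: "\<rho> \<in> carrier_mat d d" using assms by (simp add: density_op_def positive_op_def)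
  have "sesq_form n (\<lambda>r c. pad_mat d n \<rho> $$ (r, c)) v = sesq_form d (\<lambda>r c. \<rho> $$ (r, c)) v" for v
  proof -
    have "(\<Sum>c<n. pad_mat d n \<rho> $$ (r, c) * v c) = (if r < d then \<Sum>c<d. \<rho> $$ (r, c) * v c else 0)"
      if "r < n" for r
    proof -
      have "(\<Sum>c<n. pad_mat d n \<rho> $$ (r, c) * v c)
        = (\<Sum>c<n. if c < d then (if r < d then \<rho> $$ (r, c) * v c else 0) else 0)"
        using that by (intro sum.cong) (auto simp: pad_mat_def)
      then show ?thesis using assms(2) by (simp add: sum_lessThan_restrict)
    qed
    then have "sesq_form n (\<lambda>r c. pad_mat d n \<rho> $$ (r, c)) v
      = (\<Sum>r<n. if r < d then (\<Sum>c<d. \<rho> $$ (r, c) * v c) * cnj (v r) else 0)"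
      unfolding sesq_form_def by (intro sum.cong) auto
    then show ?thesis using assms(2) by (simp add: sum_lessThan_restrict sesq_form_def)
  qed
  then have "positive_op n (pad_mat d n \<rho>)"
    using assms positive_op_sesq_form[OF \<rho>] positive_op_sesq_form[of "pad_mat d n \<rho>" n]
    by (simp add: density_op_def pad_mat_def)
  moreover have "mat_trace (pad_mat d n \<rho>) = (\<Sum>i<n. if i < d then \<rho> $$ (i, i) else 0)"
    by (auto simp: mat_trace_def pad_mat_def intro!: sum.cong)
  ultimately show ?thesis
    using assms \<rho> by (simp add: density_op_def mat_trace_def sum_lessThan_restrict)
qed

text \<open>A padded state sees only the top-left block of \<open>B\<close>. Agreement of a dilation
  with the POVM on that block therefore preserves the probabilities.\<close>

lemma mat_trace_pad_mat_mult:
  fixes \<rho> :: "complex mat"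
  assumes "d \<le> n" "\<rho> \<in> carrier_mat d d" "A \<in> carrier_mat d d" "B \<in> carrier_mat n n"
    "\<And>r c. r < d \<Longrightarrow> c < d \<Longrightarrow> B $$ (r, c) = A $$ (r, c)"
  shows "mat_trace (pad_mat d n \<rho> * B) = mat_trace (\<rho> * A)"
proof -
  have "mat_trace (pad_mat d n \<rho> * B) = (\<Sum>r<n. \<Sum>c<n. pad_mat d n \<rho> $$ (r, c) * B $$ (c, r))"
    using assms by (auto simp: mat_trace_def scalar_prod_def pad_mat_def atLeast0LessThan intro!: sum.cong)
  also have "\<dots> = (\<Sum>r<n. \<Sum>c<n. if c < d then (if r < d then \<rho> $$ (r, c) * A $$ (c, r) else 0) else 0)"
    using assms by (intro sum.cong refl) (auto simp: pad_mat_def)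
  also have "\<dots> = (\<Sum>r<n. if r < d then \<Sum>c<d. \<rho> $$ (r, c) * A $$ (c, r) else 0)"
    using assms by (intro sum.cong refl) (simp add: sum_lessThan_restrict)
  also have "\<dots> = mat_trace (\<rho> * A)"
    using assms by (auto simp: sum_lessThan_restrict mat_trace_def scalar_prod_def atLeast0LessThan intro!: sum.cong)
  finally show ?thesis .
qed

text \<open>Padding is linear, which is how the preparation equivalences survive the passage to the
  larger space.\<close>

lemma mat_sum_smult_pad_mat:
  fixes \<rho> :: "nat \<Rightarrow> complex mat"
  assumes "\<And>x. x < X \<Longrightarrow> \<rho> x \<in> carrier_mat d d"
  shows "mat_sum n (\<lambda>x. a x \<cdot>\<^sub>m pad_mat d n (\<rho> x)) {..<X}
    = pad_mat d n (mat_sum d (\<lambda>x. a x \<cdot>\<^sub>m \<rho> x) {..<X})"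
proof -
  have "(a x \<cdot>\<^sub>m \<rho> x) $$ (r, c) = a x * \<rho> x $$ (r, c)" if "x < X" "r < d" "c < d" for x r c
    using assms[of x] that by auto
  then show ?thesis
    by (intro eq_matI) (auto simp: mat_sum_def pad_mat_def intro!: sum.cong sum.neutral)
qed

section \<open>Simultaneous dilation of all measurements\<close>

lemma quantum_realisation_projective:
  assumes real: "quantum_realisation T d \<rho> M p" and K: "num_outcomes T > 0"
  shows "\<exists>n \<rho>' P. quantum_realisation T n \<rho>' P p \<and> (\<forall>y<num_meas T. projective (num_outcomes T) (P y))"
proof -
  let ?K = "num_outcomes T"
  \<comment> \<open>The dimension depends only on \<open>d\<close> and the number of outcomes, so
    the dilations chosen for different \<open>y\<close> all act on the same space and share the
    padded states.\<close>
  define n where "n = d + ?K * d"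
  define dilates where "dilates y P \<longleftrightarrow> povm n ?K P \<and> projective ?K P \<and>
      (\<forall>k<?K. \<forall>r<d. \<forall>c<d. P k $$ (r, c) = M y k $$ (r, c))" for y P
  have "\<exists>P. dilates y P" if "y < num_meas T" for y
  proof -
    have "povm d ?K (M y)" using real that by (simp add: quantum_realisation_def)
    from povm_dilation[OF this K] show ?thesis unfolding dilates_def n_def .
  qed
  then obtain P where "\<And>y. y < num_meas T \<Longrightarrow> dilates y (P y)"
    by metis
  then have P: "povm n ?K (P y)" "projective ?K (P y)"
    "\<And>k r c. k < ?K \<Longrightarrow> r < d \<Longrightarrow> c < d \<Longrightarrow> P y k $$ (r, c) = M y k $$ (r, c)"
    if "y < num_meas T" for y
    using that unfolding dilates_def by auto
  define \<rho>' where "\<rho>' x = pad_mat d n (\<rho> x)" for x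
  have \<rho>: "\<rho> x \<in> carrier_mat d d" if "x < num_preps T" for x
    using real that by (simp add: quantum_realisation_def density_op_def positive_op_def)
  have M: "M y k \<in> carrier_mat d d" if "y < num_meas T" "k < ?K" for y k
    using real that by (simp add: quantum_realisation_def povm_def positive_op_def)
  have "quantum_realisation T n \<rho>' P p"
    unfolding quantum_realisation_def
  proof (intro conjI allI impI ballI)
    fix x assume "x < num_preps T"
    then show "density_op n (\<rho>' x)"
      using real by (auto simp: quantum_realisation_def \<rho>'_def n_def intro: density_op_pad_mat)
  next
    fix y assume "y < num_meas T"
    then show "povm n ?K (P y)" using P by blast
  next
    fix x y k assume xyk: "x < num_preps T" "y < num_meas T" "k < ?K"
    then have "P y k \<in> carrier_mat n n"
      using P by (simp add: povm_def positive_op_def)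
    then have "mat_trace (\<rho>' x * P y k) = mat_trace (\<rho> x * M y k)"
      unfolding \<rho>'_def using xyk P \<rho> M by (intro mat_trace_pad_mat_mult) (auto simp: n_def)
    then show "complex_of_real (p (x, y, k)) = mat_trace (\<rho>' x * P y k)"
      using real xyk by (simp add: quantum_realisation_def)
  next
    fix as a b assume ab: "as \<in> set (prep_equivs T)" "a \<in> set as" "b \<in> set as"
    have equivs: "\<forall>as \<in> set (prep_equivs T). \<forall>a \<in> set as. \<forall>b \<in> set as.
        mat_sum d (\<lambda>x. complex_of_real (a x) \<cdot>\<^sub>m \<rho> x) {..<num_preps T} =
        mat_sum d (\<lambda>x. complex_of_real (b x) \<cdot>\<^sub>m \<rho> x) {..<num_preps T}"
      using real unfolding quantum_realisation_def by (elim conjE)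
    have pad: "mat_sum n (\<lambda>x. f x \<cdot>\<^sub>m pad_mat d n (\<rho> x)) {..<num_preps T}
        = pad_mat d n (mat_sum d (\<lambda>x. f x \<cdot>\<^sub>m \<rho> x) {..<num_preps T})" for f
      by (rule mat_sum_smult_pad_mat) (rule \<rho>)
    show "mat_sum n (\<lambda>x. complex_of_real (a x) \<cdot>\<^sub>m \<rho>' x) {..<num_preps T} =
        mat_sum n (\<lambda>x. complex_of_real (b x) \<cdot>\<^sub>m \<rho>' x) {..<num_preps T}"
      unfolding \<rho>'_def pad
      by (rule arg_cong[OF bspec[OF bspec[OF bspec[OF equivs ab(1)] ab(2)] ab(3)]])
  qed
  then show ?thesis using P(2) by blast
qed

theorem mainTheorem5:
  fixes T :: scenario
  assumes "is_scenario T"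
  shows "quantum_set T = projective_quantum_set T"
proof
  show "projective_quantum_set T \<subseteq> quantum_set T"
    unfolding quantum_set_def projective_quantum_set_def by blast
  have K: "num_outcomes T > 0"
    using assms by (simp add: is_scenario_def)
  show "quantum_set T \<subseteq> projective_quantum_set T"
  proof
    fix p assume "p \<in> quantum_set T"
    then obtain d \<rho> M where "p \<in> behaviours T" "quantum_realisation T d \<rho> M p"
      unfolding quantum_set_def by blast
    with quantum_realisation_projective[OF _ K] show "p \<in> projective_quantum_set T"
      unfolding projective_quantum_set_def by blast
  qed
qed

end
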